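(* Let $K$ be a countable (infinite) field and let $(F_N)_{N\in\mathbb{N}}$ be a double F\o lner sequence in $K$. For any finite coloring $K=C_1\cup\dots\cup C_r$ there exist an index $i$, a subset $D\subset K$ with $\bar d_{(F_N)}(D)>0$, and for each $u\in D$ a set $D_u\subset K$ with $\bar d_{(F_N)}(D_u)>0$, such that for every $u\in D$ and every $y\in D_u$ we have $\{u,\,y+u,\,yu\}\subset C_i$.
   Context: A double F\o lner sequence in a countable field $K$ is a sequence $(F_N)$ of non-empty finite subsets of $K$ such that for each $x\in K^*:=K\setminus\{0\}$, $\lim_{N\to\infty}|F_N\cap(F_N+x)|/|F_N|=\lim_{N\to\infty}|F_N\cap(xF_N)|/|F_N|=1$. For $E\subset K$, the upper density is $\bar d_{(F_N)}(E):=\limsup_{N\to\infty}|E\cap F_N|/|F_N|$. *)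

theory Defs
  imports Complex_Main "HOL-Library.Extended_Real" "HOL-Library.Countable_Set"
    "HOL-Library.Liminf_Limsup"
begin

definition double_folner :: "(nat \<Rightarrow> 'a::field set) \<Rightarrow> bool" where
  "double_folner F \<longleftrightarrow>
     (\<forall>N. finite (F N) \<and> F N \<noteq> {}) \<and>
     (\<forall>x. x \<noteq> 0 \<longrightarrow>
        (\<lambda>N. real (card (F N \<inter> (\<lambda>a. a + x) ` F N)) / real (card (F N))) \<longlonglongrightarrow> 1 \<and>
        (\<lambda>N. real (card (F N \<inter> (\<lambda>a. x * a) ` F N)) / real (card (F N))) \<longlonglongrightarrow> 1)"

text \<open>The density is \<^typ>\<open>ereal\<close>-valued because \<^const>\<open>limsup\<close> requires a complete linear order;
  for a sequence of nonempty finite sets it lies between 0 and 1.\<close>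

definition upper_density :: "(nat \<Rightarrow> 'a set) \<Rightarrow> 'a set \<Rightarrow> ereal" where
  "upper_density F E = limsup (\<lambda>N. ereal (real (card (E \<inter> F N)) / real (card (F N))))"

end

(* The proof replaces the ergodic theory of the affine group by a mean m on bounded functions,
   namely a cluster point of the averages over F N, and uses no completeness. Let As be the colours
   of positive m-measure. On the product mean over a list of such colours, let f be the indicator
   of the product set; it suffices that the average over u of the correlation of f(x + u) with
   f(u x) is at least (mean f)^2 > 0, for then the set R of all u that are good for every colour in
   As at once has positive mean, and R must meet one of these colours in positive mean.
   By van der Corput's argument f(x + u) may be replaced by h(x + u) for any convex combination h
   of translates of f. Taking h almost invariant under translations turns the correlation into that
   of h(x) with h(u x), and the same device applied to dilations bounds this below by (mean h)^2. *)

theory Submission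
  imports Defs "HOL-Analysis.Analysis"
begin

section \<open>Bounded functions and finitely additive means\<close>

definition bnd :: "('x \<Rightarrow> real) \<Rightarrow> bool" where
  "bnd f \<longleftrightarrow> (\<exists>c. \<forall>x. \<bar>f x\<bar> \<le> c)"

lemma power2_le_of_abs_le: "\<bar>x\<bar> \<le> c \<Longrightarrow> x\<^sup>2 \<le> c\<^sup>2" for x c :: real
  using power_mono[of "\<bar>x\<bar>" c 2] by simp

lemma bndI: "(\<And>x. \<bar>f x\<bar> \<le> c) \<Longrightarrow> bnd f"
  by (auto simp: bnd_def)

lemma bndE:
  assumes "bnd f"
  obtains c where "0 \<le> c" "\<And>x. \<bar>f x\<bar> \<le> c"
  using assms abs_ge_zero order_trans unfolding bnd_def by metis

lemma bnd_const [simp]: "bnd (\<lambda>_. c)"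
  by (rule bndI[of _ "\<bar>c\<bar>"]) simp

lemma bnd_indicator [simp]: "bnd (indicator A)"
  by (rule bndI[of _ 1]) (simp add: indicator_def)

lemma bnd_add: "bnd f \<Longrightarrow> bnd g \<Longrightarrow> bnd (\<lambda>x. f x + g x)"
  by (elim bndE, rule bndI, rule order_trans[OF abs_triangle_ineq add_mono])

lemma bnd_mult: "bnd f \<Longrightarrow> bnd g \<Longrightarrow> bnd (\<lambda>x. f x * g x)"
  by (elim bndE, rule bndI, subst abs_mult, rule mult_mono) auto

lemma bnd_diff: "bnd f \<Longrightarrow> bnd g \<Longrightarrow> bnd (\<lambda>x. f x - g x)"
  using bnd_add[of f "\<lambda>x. -1 * g x"] bnd_mult[of "\<lambda>_. -1" g] by simp

lemma bnd_power2: "bnd f \<Longrightarrow> bnd (\<lambda>x. (f x)\<^sup>2)"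
  unfolding power2_eq_square by (rule bnd_mult)

lemma bnd_half: "bnd f \<Longrightarrow> bnd (\<lambda>x. f x / 2)"
  using bnd_mult[of f "\<lambda>_. 1/2"] by simp

lemma bnd_sum: "(\<And>i. i \<in> I \<Longrightarrow> bnd (f i)) \<Longrightarrow> bnd (\<lambda>x. \<Sum>i\<in>I. f i x)"
  by (induction I rule: infinite_finite_induct) (auto intro: bnd_add)

lemma bnd_comp: "bnd f \<Longrightarrow> bnd (\<lambda>x. f (t x))"
  by (auto simp: bnd_def)

lemmas bnd_intros = bnd_const bnd_indicator bnd_add bnd_mult bnd_diff bnd_power2 bnd_half bnd_sum

locale mean =
  fixes L :: "('x \<Rightarrow> real) \<Rightarrow> real"
  assumes add: "bnd f \<Longrightarrow> bnd g \<Longrightarrow> L (\<lambda>x. f x + g x) = L f + L g"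
    and scale: "bnd f \<Longrightarrow> L (\<lambda>x. c * f x) = c * L f"
    and nonneg: "bnd f \<Longrightarrow> (\<And>x. 0 \<le> f x) \<Longrightarrow> 0 \<le> L f"
    and one: "L (\<lambda>_. 1) = 1"
begin

lemma const: "L (\<lambda>_. c) = c"
  using scale[of "\<lambda>_. 1" c] by (simp add: one)

lemma diff: "bnd f \<Longrightarrow> bnd g \<Longrightarrow> L (\<lambda>x. f x - g x) = L f - L g"
  using add[of f "\<lambda>x. -1 * g x"] scale[of g "-1"] bnd_mult[of "\<lambda>_. -1" g] by simp

lemma half: "bnd f \<Longrightarrow> L (\<lambda>x. f x / 2) = L f / 2"
  using scale[of f "1/2"] by simp

lemma mono: "bnd f \<Longrightarrow> bnd g \<Longrightarrow> (\<And>x. f x \<le> g x) \<Longrightarrow> L f \<le> L g"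
  using nonneg[of "\<lambda>x. g x - f x"] by (simp add: diff bnd_diff)

lemma sum: "(\<And>i. i \<in> I \<Longrightarrow> bnd (f i)) \<Longrightarrow> L (\<lambda>x. \<Sum>i\<in>I. f i x) = (\<Sum>i\<in>I. L (f i))"
  by (induction I rule: infinite_finite_induct) (auto simp: const add bnd_sum)

lemma abs_le:
  assumes "\<And>x. \<bar>f x\<bar> \<le> c"
  shows "\<bar>L f\<bar> \<le> c"
proof -
  have "bnd f" using assms by (rule bndI)
  then show ?thesis
    using mono[of f "\<lambda>_. c"] mono[of "\<lambda>_. -c" f] assms
    by (simp add: const abs_le_iff) (metis minus_le_iff abs_le_D2 minus_le_iff)
qed

text \<open>The mean of the square of \<open>f - t * g\<close> is a nonnegative quadratic in
  \<open>t\<close>. Since \<open>L\<close> may vanish on nonzero squares, the case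
  \<open>?c = 0\<close> needs its own choice of \<open>t\<close>.\<close>

lemma cauchy_schwarz:
  assumes [simp]: "bnd f" "bnd g"
  shows "(L (\<lambda>x. f x * g x))\<^sup>2 \<le> L (\<lambda>x. (f x)\<^sup>2) * L (\<lambda>x. (g x)\<^sup>2)"
proof -
  let ?a = "L (\<lambda>x. (f x)\<^sup>2)" and ?b = "L (\<lambda>x. f x * g x)" and ?c = "L (\<lambda>x. (g x)\<^sup>2)"
  have q: "0 \<le> ?a - 2 * t * ?b + t\<^sup>2 * ?c" for t
  proof -
    have "0 \<le> L (\<lambda>x. (f x - t * g x)\<^sup>2)"
      by (intro nonneg bnd_intros) auto
    also have "(\<lambda>x. (f x - t * g x)\<^sup>2) = (\<lambda>x. ((f x)\<^sup>2 - (2 * t) * (f x * g x)) + t\<^sup>2 * (g x)\<^sup>2)"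
      by (auto simp: power2_eq_square algebra_simps)
    also have "L \<dots> = ?a - 2 * t * ?b + t\<^sup>2 * ?c"
      by (simp add: add diff scale bnd_intros)
    finally show ?thesis .
  qed
  show ?thesis
  proof (cases "?c = 0")
    case True
    have "?b = 0"
    proof (rule ccontr)
      assume "?b \<noteq> 0"
      \<comment> \<open>With \<open>?c = 0\<close> the quadratic is affine in \<open>t\<close>, and
        this \<open>t\<close> gives it the value -1.\<close>
      then show False using q[of "(?a + 1) / (2 * ?b)"] True by (simp add: field_simps)
    qed
    then show ?thesis using True by simp
  next
    case False
    have "0 \<le> ?c" by (intro nonneg bnd_intros) auto
    then have "?c > 0" using False by simp
    then show ?thesis using q[of "?b / ?c"] by (simp add: field_simps power2_eq_square)
  qed
qed

lemma abs_mult_le: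
  assumes "bnd f" "bnd g" "L (\<lambda>x. (f x)\<^sup>2) \<le> e\<^sup>2" "0 \<le> e" "\<And>x. \<bar>g x\<bar> \<le> 1"
  shows "\<bar>L (\<lambda>x. f x * g x)\<bar> \<le> e"
proof -
  have "L (\<lambda>x. (g x)\<^sup>2) \<le> L (\<lambda>_. 1)"
    using assms by (intro mono bnd_intros) (auto simp: abs_square_le_1)
  moreover have "0 \<le> L (\<lambda>x. (f x)\<^sup>2)" using assms by (intro nonneg bnd_intros) auto
  moreover have "0 \<le> L (\<lambda>x. (g x)\<^sup>2)" using assms by (intro nonneg bnd_intros) auto
  ultimately have "L (\<lambda>x. (f x)\<^sup>2) * L (\<lambda>x. (g x)\<^sup>2) \<le> e\<^sup>2 * 1"
    using assms(3) by (intro mult_mono) (auto simp: one)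
  then have "(L (\<lambda>x. f x * g x))\<^sup>2 \<le> e\<^sup>2"
    using cauchy_schwarz[OF assms(1,2)] by linarith
  then show ?thesis using assms(4) abs_le_square_iff[of _ e] by fastforce
qed

end

section \<open>Almost invariant elements in convex hulls of orbits\<close>

text \<open>Midpoints stand in for general convex combinations: the parallelogram law uses no
  others, and an identity linear in \<open>h\<close> then follows by induction with one case per
  rule.\<close>

inductive_set midhull :: "('x \<Rightarrow> 'x) set \<Rightarrow> ('x \<Rightarrow> real) \<Rightarrow> ('x \<Rightarrow> real) set" for S f where
  base: "f \<in> midhull S f"
| shift: "h \<in> midhull S f \<Longrightarrow> s \<in> S \<Longrightarrow> (\<lambda>x. h (s x)) \<in> midhull S f"
| mid: "h \<in> midhull S f \<Longrightarrow> k \<in> midhull S f \<Longrightarrow> (\<lambda>x. (h x + k x) / 2) \<in> midhull S f"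

lemma midhull_bnd: "h \<in> midhull S f \<Longrightarrow> bnd f \<Longrightarrow> bnd h"
  by (induction rule: midhull.induct) (auto intro: bnd_half bnd_add bnd_comp)

context mean
begin

context
  fixes S :: "('x \<Rightarrow> 'x) set" and f :: "'x \<Rightarrow> real"
  assumes inv: "\<And>s h. s \<in> S \<Longrightarrow> bnd h \<Longrightarrow> L (\<lambda>x. h (s x)) = L h"
    and bnd_f: "bnd f"
begin

lemma midhull_mean: "h \<in> midhull S f \<Longrightarrow> L h = L f"
  by (induction rule: midhull.induct)
    (simp_all add: inv midhull_bnd[OF _ bnd_f] half add bnd_add)

text \<open>Stands in for the orthogonal projection onto the \<open>S\<close>-invariant functions: by the
  parallelogram law an element of almost minimal norm in the convex hull of the orbit is moved
  little by \<open>S\<close>, and no completeness is needed.\<close>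

lemma almost_invariant:
  assumes "0 < e"
  obtains h where "h \<in> midhull S f" "\<And>s. s \<in> S \<Longrightarrow> L (\<lambda>x. (h (s x) - h x)\<^sup>2) \<le> e"
proof -
  let ?N = "\<lambda>h. L (\<lambda>x. (h x)\<^sup>2)"
  define d where "d = Inf (?N ` midhull S f)"
  have bh: "bnd h" if "h \<in> midhull S f" for h
    using that bnd_f by (rule midhull_bnd)
  have "bdd_below (?N ` midhull S f)"
    by (rule bdd_belowI2[of _ 0]) (auto intro!: nonneg bnd_power2 dest: bh)
  then have d: "d \<le> ?N h" if "h \<in> midhull S f" for h
    using that unfolding d_def by (auto intro: cInf_lower)
  have "?N ` midhull S f \<noteq> {}" using midhull.base by blast
  \<comment> \<open>The midpoint of \<open>h\<close> and its shift has square norm at least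
    \<open>d\<close>, so the parallelogram law bounds that of their difference by
    \<open>4 * (?N h - d)\<close>; hence the slack \<open>e / 4\<close>.\<close>
  moreover have "Inf (?N ` midhull S f) < d + e / 4" using assms unfolding d_def by simp
  ultimately have "\<exists>y\<in>?N ` midhull S f. y < d + e / 4" by (rule cInf_lessD)
  then obtain h where h: "h \<in> midhull S f" "?N h < d + e / 4" by blast
  have "L (\<lambda>x. (h (s x) - h x)\<^sup>2) \<le> e" if s: "s \<in> S" for s
  proof -
    note [simp] = bh[OF h(1)]
    have [simp]: "bnd (\<lambda>x. h (s x))" by (rule bnd_comp) simp
    have eq: "?N (\<lambda>x. h (s x)) = ?N h"
      using inv[OF s, of "\<lambda>x. (h x)\<^sup>2"] by (simp add: bnd_intros)
    have "d \<le> L (\<lambda>x. ((h x + h (s x)) / 2)\<^sup>2)"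
      using d[OF midhull.mid[OF h(1) midhull.shift[OF h(1) s]]] .
    moreover have "L (\<lambda>x. ((h x + h (s x)) / 2)\<^sup>2) = L (\<lambda>x. (1/4) * (h x + h (s x))\<^sup>2)"
      by (simp add: power_divide)
    then have "L (\<lambda>x. ((h x + h (s x)) / 2)\<^sup>2) = L (\<lambda>x. (h x + h (s x))\<^sup>2) / 4"
      by (subst (asm) scale) (simp_all add: bnd_intros)
    moreover have "L (\<lambda>x. (h x + h (s x))\<^sup>2) + L (\<lambda>x. (h (s x) - h x)\<^sup>2) =
        L (\<lambda>x. (h x + h (s x))\<^sup>2 + (h (s x) - h x)\<^sup>2)"
      by (simp add: add bnd_intros)
    moreover have "L (\<lambda>x. (h x + h (s x))\<^sup>2 + (h (s x) - h x)\<^sup>2) =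
        L (\<lambda>x. 2 * ((h x)\<^sup>2 + (h (s x))\<^sup>2))"
      by (intro arg_cong[of _ _ L]) (auto simp: power2_eq_square algebra_simps)
    then have "L (\<lambda>x. (h x + h (s x))\<^sup>2 + (h (s x) - h x)\<^sup>2) = 2 * (?N h + ?N h)"
      by (simp add: scale add bnd_intros eq)
    ultimately show ?thesis using h(2) by argo
  qed
  then show ?thesis using that h by blast
qed

end

end

section \<open>Product means, image means and affine actions\<close>

lemma bnd_fibre: "bnd f \<Longrightarrow> bnd (\<lambda>x. f (u, x))"
  by (auto simp: bnd_def)

lemma (in mean) bnd_fibre_mean:
  assumes "bnd f"
  shows "bnd (\<lambda>u. L (\<lambda>x. f (u, x)))"
  using assms by (elim bndE) (rule bndI, rule abs_le)

text \<open>Finitely additive means need not commute, so the order is fixed with \<open>m\<close>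
  outside; the two are never exchanged.\<close>

lemma mean_prod:
  assumes "mean m" "mean L"
  shows "mean (\<lambda>f. m (\<lambda>u. L (\<lambda>x. f (u, x))))"
proof -
  interpret m: mean m by fact
  interpret L: mean L by fact
  show ?thesis
    by standard
      (simp_all add: L.add L.scale L.one m.add m.scale m.one bnd_fibre L.bnd_fibre_mean
        L.nonneg m.nonneg)
qed

lemma mean_push:
  assumes "mean L"
  shows "mean (\<lambda>f. L (\<lambda>x. f (t x)))"
proof -
  interpret mean L by fact
  show ?thesis
    by standard (simp_all add: add scale one nonneg bnd_comp)
qed

text \<open>\<open>T a b\<close> is the action of the map \<open>x \<mapsto> a x + b\<close>; the degenerate case \<open>a = 0\<close> is allowed in the
  composition law so that formulas need no guard, but it need not preserve the mean.\<close>

locale affine_mean = mean L for L :: "('x \<Rightarrow> real) \<Rightarrow> real" +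
  fixes T :: "'a::field \<Rightarrow> 'a \<Rightarrow> 'x \<Rightarrow> 'x"
  assumes T_comp: "T a b (T c d x) = T (a * c) (a * d + b) x"
    and T_id: "T 1 0 x = x"
    and invariant: "a \<noteq> 0 \<Longrightarrow> bnd f \<Longrightarrow> L (\<lambda>x. f (T a b x)) = L f"

abbreviation (input) line_action :: "'a::field \<Rightarrow> 'a \<Rightarrow> 'a \<Rightarrow> 'a" where
  "line_action a b x \<equiv> a * x + b"

text \<open>\<open>m\<close> averages the parameter \<open>u\<close>, and \<open>L\<close> the point
  moved by \<open>T\<close>. In the application \<open>L\<close> is a finite power of
  \<open>m\<close>, living on lists.\<close>

locale affine_pair = U: affine_mean m line_action + X: affine_mean L T
  for m :: "('a::field \<Rightarrow> real) \<Rightarrow> real" and L :: "('x \<Rightarrow> real) \<Rightarrow> real"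
    and T :: "'a \<Rightarrow> 'a \<Rightarrow> 'x \<Rightarrow> 'x" +
  assumes infinite_field: "infinite (UNIV :: 'a set)"
begin

text \<open>Translation invariance gives all points the same mass, and arbitrarily many of them have
  total mass at most 1. This allows \<open>u = 0\<close>, where \<open>T u 0\<close> need not
  preserve the mean, to be ignored.\<close>

lemma singleton_null: "m (indicator {x}) = 0"
proof (rule ccontr)
  define z where "z = m (indicator {0})"
  have pt: "m (indicator {y}) = z" for y
  proof -
    have "indicator {y} = (\<lambda>x. indicator {0} (1 * x + (- y)) :: real)"
      by (auto simp: indicator_def)
    then show ?thesis
      using U.invariant[of 1 "indicator {0}" "- y"] by (simp add: z_def)
  qed
  assume "m (indicator {x}) \<noteq> 0"
  moreover have "0 \<le> z" unfolding z_def by (intro U.nonneg) auto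
  ultimately have "0 < z" using pt[of x] by simp
  then obtain n :: nat where n: "1 < real n * z"
    using reals_Archimedean3 by blast
  obtain S :: "'a set" where S: "finite S" "card S = n"
    using infinite_arbitrarily_large[OF infinite_field] by blast
  have "real n * z = (\<Sum>y\<in>S. m (indicator {y}))" using S pt by simp
  also have "\<dots> = m (\<lambda>x. \<Sum>y\<in>S. indicator {y} x)" by (subst U.sum) auto
  also have "\<dots> \<le> m (\<lambda>_. 1)"
  proof (intro U.mono bnd_intros)
    show "(\<Sum>y\<in>S. indicator {y} x) \<le> (1::real)" for x
      using S(1) by (cases "x \<in> S") (simp_all add: indicator_def)
  qed
  finally show False using n by (simp add: U.one)
qed

lemma mono_off_0:
  assumes [simp]: "bnd f" "bnd g" and le: "\<And>u. u \<noteq> 0 \<Longrightarrow> f u \<le> g u"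
  shows "m f \<le> m g"
proof -
  obtain c where c: "\<And>x. \<bar>f x - g x\<bar> \<le> c"
    using bndE[OF bnd_diff[of f g]] by auto
  have "m f \<le> m (\<lambda>u. g u + c * indicator {0} u)"
  proof (intro U.mono bnd_intros)
    show "f u \<le> g u + c * indicator {0} u" for u
      using c[of u] le[of u] by (cases "u = 0") auto
  qed auto
  also have "\<dots> = m g"
    by (simp add: U.add U.scale bnd_intros singleton_null)
  finally show ?thesis .
qed

section \<open>Joint averages over the parameter and the point\<close>

definition J :: "('a \<times> 'x \<Rightarrow> real) \<Rightarrow> real" where
  "J f = m (\<lambda>u. L (\<lambda>x. f (u, x)))"

sublocale J: mean J
  using mean_prod[OF U.mean_axioms X.mean_axioms] by (simp add: J_def[abs_def])

lemma J_mono_off_0: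
  assumes "bnd f" "bnd g" "\<And>u. u \<noteq> 0 \<Longrightarrow> L (\<lambda>x. f (u, x)) \<le> L (\<lambda>x. g (u, x))"
  shows "J f \<le> J g"
  unfolding J_def using assms by (intro mono_off_0 X.bnd_fibre_mean)

text \<open>For fixed \<open>u\<close> the inner mean sees a single affine map, so the coefficients
  of a substitution in \<open>x\<close> may depend on \<open>u\<close> in any way.\<close>

lemma J_fibre:
  assumes "bnd f" "\<And>u. u \<noteq> 0 \<Longrightarrow> a u \<noteq> 0"
  shows "J (\<lambda>p. f (fst p, T (a (fst p)) (b (fst p)) (snd p))) = J f"
proof -
  have "bnd (\<lambda>p. f (fst p, T (a (fst p)) (b (fst p)) (snd p)))"
    using assms(1) by (rule bnd_comp)
  moreover have "L (\<lambda>x. f (u, T (a u) (b u) x)) = L (\<lambda>x. f (u, x))" if "u \<noteq> 0" for u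
    using assms that by (intro X.invariant bnd_fibre) auto
  ultimately show ?thesis
    using assms(1) by (intro antisym J_mono_off_0) simp_all
qed

lemma J_base:
  assumes "bnd f" "a \<noteq> 0"
  shows "J (\<lambda>p. f (a * fst p + b, snd p)) = J f"
  using U.invariant[OF assms(2) X.bnd_fibre_mean[OF assms(1)]] by (simp add: J_def)

lemma J_cong_off_0:
  assumes "bnd f" "bnd g" "\<And>u x. u \<noteq> 0 \<Longrightarrow> f (u, x) = g (u, x)"
  shows "J f = J g"
  using assms by (intro antisym J_mono_off_0) simp_all

section \<open>Van der Corput's argument for sums against products\<close>

text \<open>Squaring is at most two-to-one, so an infinite field has infinitely many squares; one
  root is taken of each of \<open>n\<close> nonzero ones.\<close>

lemma ex_distinct_squares: "\<exists>B::'a set. finite B \<and> card B = n \<and> 0 \<notin> B \<and> inj_on (\<lambda>b. b\<^sup>2) B"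
proof -
  have "infinite (range (\<lambda>b::'a. b\<^sup>2))"
  proof
    assume fin: "finite (range (\<lambda>b::'a. b\<^sup>2))"
    then obtain c :: 'a where "infinite {b. b\<^sup>2 = c\<^sup>2}"
      using pigeonhole_infinite[OF infinite_field fin] by auto
    moreover have "finite {b. b\<^sup>2 = c\<^sup>2}"
      by (rule finite_subset[of _ "{c, - c}"]) (auto simp: power2_eq_iff)
    ultimately show False by simp
  qed
  then have "infinite (range (\<lambda>b::'a. b\<^sup>2) - {0})" by simp
  then obtain Q :: "'a set" where Q: "finite Q" "card Q = n" "Q \<subseteq> range (\<lambda>b. b\<^sup>2) - {0}"
    using infinite_arbitrarily_large by blast
  then obtain B where B: "inj_on (\<lambda>b::'a. b\<^sup>2) B" "Q = (\<lambda>b. b\<^sup>2) ` B"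
    by (metis (no_types, lifting) Diff_subset order_trans subset_image_inj)
  then have "0 \<notin> B" using Q(3) by auto
  with B Q show ?thesis by (auto simp: card_image finite_image_iff)
qed

text \<open>Van der Corput's argument: replacing \<open>u\<close> by \<open>u b\<close> for \<open>n\<close> values of \<open>b\<close> with distinct squares
  gives functions that are pairwise orthogonal on average over \<open>u\<close>.\<close>

lemma coboundary_average:
  assumes f: "bnd f" and k: "bnd k"
  shows "J (\<lambda>p. (f (T 1 (fst p) (snd p)) - f (T 1 v (T 1 (fst p) (snd p)))) * k (T (fst p) 0 (snd p))) = 0"
proof (rule ccontr)
  define g where "g x = f x - f (T 1 v x)" for x
  have bf: "bnd (\<lambda>p. f (t p))" and bk: "bnd (\<lambda>p. k (t p))" for t :: "'y \<Rightarrow> 'x"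
    using f k by (auto intro: bnd_comp)
  have bg: "bnd (\<lambda>p. g (t p))" for t :: "'y \<Rightarrow> 'x"
    unfolding g_def by (intro bnd_intros bf)
  obtain G where G: "\<And>x. \<bar>g x\<bar> \<le> G" using bndE[OF bg[of "\<lambda>x. x"]] by blast
  obtain K where K: "\<And>x. \<bar>k x\<bar> \<le> K" using bndE[OF k] by blast
  let ?z = "J (\<lambda>p. g (T 1 (fst p) (snd p)) * k (T (fst p) 0 (snd p)))"
  \<comment> \<open>Substituting \<open>u * b\<close> for \<open>u\<close> and then
    \<open>x / (u * b)\<close> for \<open>x\<close> frees the factor \<open>k\<close> of
    \<open>u\<close> and turns the other factor into \<open>q b\<close>.\<close>
  define q where "q b p = g (T (1 / (fst p * b)) (fst p * b) (snd p))" for b p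
  have bq: "bnd (q b)" for b unfolding q_def by (rule bg)
  have z: "?z = J (\<lambda>p. q b p * k (snd p))" if b: "b \<noteq> 0" for b
  proof -
    have "?z = J (\<lambda>p. g (T 1 (b * fst p + 0) (snd p)) * k (T (b * fst p + 0) 0 (snd p)))"
      using J_base[OF _ b, of "\<lambda>p. g (T 1 (fst p) (snd p)) * k (T (fst p) 0 (snd p))" 0]
      by (simp add: bnd_mult bg bk)
    also have "\<dots> = J (\<lambda>p. g (T 1 (b * fst p) (T (1 / (fst p * b)) 0 (snd p))) *
        k (T (b * fst p) 0 (T (1 / (fst p * b)) 0 (snd p))))"
      using J_fibre[of "\<lambda>p. g (T 1 (b * fst p) (snd p)) * k (T (b * fst p) 0 (snd p))"
          "\<lambda>u. 1 / (u * b)" "\<lambda>_. 0"] b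
      by (simp add: bnd_mult bg bk)
    also have "\<dots> = J (\<lambda>p. q b p * k (snd p))"
    proof (rule J_cong_off_0)
      fix u x assume u: "(u::'a) \<noteq> 0"
      then have "u * b * (1 / (u * b)) = 1" using b by simp
      then show "g (T 1 (b * fst (u, x)) (T (1 / (fst (u, x) * b)) 0 (snd (u, x)))) *
        k (T (b * fst (u, x)) 0 (T (1 / (fst (u, x) * b)) 0 (snd (u, x)))) = q b (u, x) * k (snd (u, x))"
        by (simp only: q_def X.T_comp X.T_id fst_conv snd_conv mult.commute[of b u] mult_zero_right
          mult_1 add_0_left add_0_right)
    qed (intro bnd_mult bg bk bq)+
    finally show ?thesis .
  qed
  \<comment> \<open>The substitution of \<open>u * b * x - (u * b)\<^sup>2\<close> for
    \<open>x\<close> undoes the map inside \<open>q b\<close> and leaves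
    \<open>b / c * x + d * u\<close> inside \<open>q c\<close>. Distinct squares make
    \<open>d\<close> nonzero, so \<open>d * u\<close> may be replaced by \<open>u\<close>.\<close>
  have orth: "J (\<lambda>p. q b p * q c p) = 0" if b: "b \<noteq> 0" and c: "c \<noteq> 0" and ne: "b\<^sup>2 \<noteq> c\<^sup>2" for b c
  proof -
    define d where "d = c - b\<^sup>2 / c"
    have d: "d \<noteq> 0" using c ne by (auto simp: d_def field_simps power2_eq_square)
    have "J (\<lambda>p. q b p * q c p) =
        J (\<lambda>p. q b (fst p, T (fst p * b) (- (fst p * b)\<^sup>2) (snd p)) *
          q c (fst p, T (fst p * b) (- (fst p * b)\<^sup>2) (snd p)))"
      using J_fibre[of "\<lambda>p. q b p * q c p" "\<lambda>u. u * b" "\<lambda>u. - (u * b)\<^sup>2"] b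
      by (simp add: bnd_mult bq)
    also have "\<dots> = J (\<lambda>p. g (snd p) * g (T (b / c) (d * fst p + 0) (snd p)))"
    proof (rule J_cong_off_0)
      fix u x assume u: "(u::'a) \<noteq> 0"
      have "- (u * b)\<^sup>2 / (u * c) + u * c = d * u" "u * b / (u * c) = b / c"
        using u c by (simp_all add: d_def field_simps power2_eq_square)
      moreover have "- (u * b)\<^sup>2 / (u * b) + u * b = 0"
        using u b by (simp add: power2_eq_square)
      ultimately show "q b (fst (u, x), T (fst (u, x) * b) (- (fst (u, x) * b)\<^sup>2) (snd (u, x))) *
          q c (fst (u, x), T (fst (u, x) * b) (- (fst (u, x) * b)\<^sup>2) (snd (u, x))) =
          g (snd (u, x)) * g (T (b / c) (d * fst (u, x) + 0) (snd (u, x)))"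
        using u b by (simp add: q_def X.T_comp X.T_id)
    qed (auto simp: q_def intro!: bnd_mult bg)
    also have "\<dots> = J (\<lambda>p. g (snd p) * g (T (b / c) (fst p) (snd p)))"
      using J_base[OF _ d, of "\<lambda>p. g (snd p) * g (T (b / c) (fst p) (snd p))" 0]
      by (simp add: bnd_mult bg)
    \<comment> \<open>Expanding the second \<open>g\<close> gives two averages that differ only by
      the translation of \<open>u\<close> by \<open>v\<close>, so they cancel.\<close>
    also have "\<dots> = J (\<lambda>p. g (snd p) * f (T (b / c) (fst p) (snd p)) -
        g (snd p) * f (T (b / c) (1 * fst p + v) (snd p)))"
      by (simp add: g_def[of "T _ _ _"] X.T_comp right_diff_distrib)
    also have "\<dots> = 0"
      using J_base[of "\<lambda>p. g (snd p) * f (T (b / c) (fst p) (snd p))" 1 v]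
      by (subst J.diff) (simp_all add: bnd_mult bg bf)
    finally show ?thesis .
  qed
  assume "J (\<lambda>p. (f (T 1 (fst p) (snd p)) - f (T 1 v (T 1 (fst p) (snd p)))) * k (T (fst p) 0 (snd p))) \<noteq> 0"
  then have "0 < ?z\<^sup>2" by (simp add: g_def)
  \<comment> \<open>Cauchy-Schwarz will bound \<open>(real n * ?z)\<^sup>2\<close> by
    \<open>real n * G\<^sup>2 * K\<^sup>2\<close>, because only the diagonal terms of the squared
    sum survive; this \<open>n\<close> is too large for that.\<close>
  then obtain n :: nat where n: "G\<^sup>2 * K\<^sup>2 < real n * ?z\<^sup>2"
    using reals_Archimedean3 by blast
  obtain B :: "'a set" where B: "finite B" "card B = n" "0 \<notin> B" "inj_on (\<lambda>b. b\<^sup>2) B"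
    using ex_distinct_squares by blast
  have "(real n * ?z)\<^sup>2 = (\<Sum>b\<in>B. J (\<lambda>p. q b p * k (snd p)))\<^sup>2"
  proof -
    have "(\<Sum>b\<in>B. J (\<lambda>p. q b p * k (snd p))) = (\<Sum>b\<in>B. ?z)"
      using B(3) by (intro sum.cong refl z[symmetric]) auto
    then show ?thesis using B(2) by simp
  qed
  also have "\<dots> = (J (\<lambda>p. (\<Sum>b\<in>B. q b p) * k (snd p)))\<^sup>2"
    using J.sum[of B "\<lambda>b p. q b p * k (snd p)"] by (simp add: sum_distrib_right bnd_mult bq bk)
  also have "\<dots> \<le> J (\<lambda>p. (\<Sum>b\<in>B. q b p)\<^sup>2) * J (\<lambda>p. (k (snd p))\<^sup>2)"
    by (intro J.cauchy_schwarz bnd_sum bq bk)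
  also have "\<dots> \<le> (real n * G\<^sup>2) * K\<^sup>2"
  proof (rule mult_mono)
    have "J (\<lambda>p. (\<Sum>b\<in>B. q b p)\<^sup>2) = J (\<lambda>p. \<Sum>b\<in>B. \<Sum>c\<in>B. q b p * q c p)"
      by (simp add: power2_eq_square sum_product)
    also have "\<dots> = (\<Sum>b\<in>B. \<Sum>c\<in>B. J (\<lambda>p. q b p * q c p))"
      using J.sum[of B "\<lambda>b p. \<Sum>c\<in>B. q b p * q c p"] J.sum[of B "\<lambda>c p. q _ p * q c p"]
      by (simp add: bnd_sum bnd_mult bq)
    also have "\<dots> \<le> (\<Sum>b\<in>B. \<Sum>c\<in>B. if b = c then G\<^sup>2 else 0)"
    proof (intro sum_mono)
      fix b c assume bc: "b \<in> B" "c \<in> B"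
      show "J (\<lambda>p. q b p * q c p) \<le> (if b = c then G\<^sup>2 else 0)"
      proof (cases "b = c")
        case True
        have "J (\<lambda>p. q b p * q c p) \<le> J (\<lambda>_. G\<^sup>2)"
          using G True by (intro J.mono bnd_mult bq bnd_const)
            (simp add: q_def power2_le_of_abs_le flip: power2_eq_square)
        then show ?thesis using True by (simp add: J.const)
      next
        case False
        moreover have "b\<^sup>2 \<noteq> c\<^sup>2" using False bc inj_onD[OF B(4), of b c] by auto
        moreover have "b \<noteq> 0" "c \<noteq> 0" using bc B(3) by auto
        ultimately show ?thesis using orth[of b c] by simp
      qed
    qed
    also have "\<dots> = real n * G\<^sup>2" using B by simp
    finally show "J (\<lambda>p. (\<Sum>b\<in>B. q b p)\<^sup>2) \<le> real n * G\<^sup>2" .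
    have "J (\<lambda>p. (k (snd p))\<^sup>2) \<le> J (\<lambda>_. K\<^sup>2)"
      using K by (intro J.mono bnd_power2 bk bnd_const) (simp add: power2_le_of_abs_le)
    then show "J (\<lambda>p. (k (snd p))\<^sup>2) \<le> K\<^sup>2" by (simp add: J.const)
    show "0 \<le> J (\<lambda>p. (k (snd p))\<^sup>2)" by (intro J.nonneg bnd_power2 bk) auto
  qed simp
  finally have "real n * (real n * ?z\<^sup>2) \<le> real n * (G\<^sup>2 * K\<^sup>2)"
    by (simp add: power2_eq_square algebra_simps)
  moreover have "n \<noteq> 0" using n by (intro notI) (simp add: mult_less_0_iff not_less)
  ultimately show False using n by simp
qed

section \<open>Lower bounds for the averaged correlations\<close>

text \<open>Both copies of \<open>h\<close> can be replaced by an almost dilation-invariant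
  \<open>k\<close> from the hull without changing the average. The correlation of \<open>k\<close>
  with its dilate is then nearly the mean of its square, which is at least the square of its
  mean.\<close>

lemma dilation_recurrence:
  assumes h: "bnd h"
  shows "(L h)\<^sup>2 \<le> J (\<lambda>p. h (snd p) * h (T (fst p) 0 (snd p)))"
proof (rule field_le_epsilon)
  fix e :: real assume e: "0 < e"
  define S where "S = {T a 0 |a. a \<noteq> 0}"
  have inv: "L (\<lambda>x. p (s x)) = L p" if "s \<in> S" "bnd p" for s p
    using that by (auto simp: S_def X.invariant)
  have bS: "bnd (\<lambda>z. p (t z))" if "p \<in> midhull S h" for p and t :: "'y \<Rightarrow> 'x"
    by (rule bnd_comp) (rule midhull_bnd[OF that h])
  obtain k where k: "k \<in> midhull S h" "\<And>s. s \<in> S \<Longrightarrow> L (\<lambda>x. (k (s x) - k x)\<^sup>2) \<le> 2 * e"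
    using X.almost_invariant[OF inv h, where e = "2 * e"] e by auto
  \<comment> \<open>A dilation by \<open>a\<close> in the second factor is absorbed by substituting
    \<open>a * u\<close> for \<open>u\<close>.\<close>
  have right: "J (\<lambda>z. p (snd z) * q (T (fst z) 0 (snd z))) = J (\<lambda>z. p (snd z) * h (T (fst z) 0 (snd z)))"
    if q: "q \<in> midhull S h" and p: "p \<in> midhull S h" for p q
    using q
  proof induction
    case (shift q s)
    then obtain a where a: "s = T a 0" "a \<noteq> 0" by (auto simp: S_def)
    have "bnd (\<lambda>z. p (snd z) * q (T (fst z) 0 (snd z)))"
      by (intro bnd_mult bS p shift)
    from J_base[OF this a(2), of 0] shift.IH show ?case
      by (simp add: a(1) X.T_comp)
  next
    case (mid q q')
    then show ?case
      by (simp add: distrib_left add_divide_distrib J.add J.half bnd_mult bnd_half bnd_add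
          bS[OF mid.hyps(1)] bS[OF mid.hyps(2)] bS[OF p])
  qed simp
  \<comment> \<open>By \<open>right\<close> the second factor may be given the same dilation as the
    first; dilations commute, so invariance of \<open>L\<close> removes both.\<close>
  have left: "J (\<lambda>z. p (snd z) * h (T (fst z) 0 (snd z))) = J (\<lambda>z. h (snd z) * h (T (fst z) 0 (snd z)))"
    if "p \<in> midhull S h" for p
    using that
  proof induction
    case (shift p s)
    then obtain a where a: "s = T a 0" "a \<noteq> 0" by (auto simp: S_def)
    have "J (\<lambda>z. p (s (snd z)) * h (T (fst z) 0 (snd z))) =
        J (\<lambda>z. p (s (snd z)) * h (s (T (fst z) 0 (snd z))))"
      using right[of "\<lambda>x. h (s x)" "\<lambda>x. p (s x)"] shift midhull.intros by metis
    also have "\<dots> = J (\<lambda>z. p (T a 0 (snd z)) * h (T (fst z) 0 (T a 0 (snd z))))"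
      by (simp add: a(1) X.T_comp mult.commute)
    also have "\<dots> = J (\<lambda>z. p (snd z) * h (T (fst z) 0 (snd z)))"
      using J_fibre[of "\<lambda>z. p (snd z) * h (T (fst z) 0 (snd z))" "\<lambda>_. a" "\<lambda>_. 0"] a(2)
      by (simp add: bnd_mult bS[OF shift.hyps(1)] bS[OF midhull.base])
    finally show ?case using shift.IH by simp
  next
    case (mid p p')
    then show ?case
      by (simp add: distrib_right add_divide_distrib J.add J.half bnd_mult bnd_half bnd_add
          bS[OF mid.hyps(1)] bS[OF mid.hyps(2)] bS[OF midhull.base])
  qed simp
  have "(L k)\<^sup>2 - e \<le> L (\<lambda>x. k x * k (T u 0 x))" if "u \<noteq> 0" for u
  proof -
    have [simp]: "bnd (\<lambda>x. k (t x))" "bnd k" for t :: "'x \<Rightarrow> 'x" using bS[OF k(1)] by auto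
    have "(L k)\<^sup>2 \<le> L (\<lambda>x. (k x)\<^sup>2)"
      using X.cauchy_schwarz[of k "\<lambda>_. 1"] by (simp add: X.one)
    moreover have "L (\<lambda>x. (k (T u 0 x))\<^sup>2) = L (\<lambda>x. (k x)\<^sup>2)"
      using X.invariant[OF that, of "\<lambda>x. (k x)\<^sup>2"] by (simp add: bnd_power2)
    moreover have "L (\<lambda>x. (k (T u 0 x) - k x)\<^sup>2) \<le> 2 * e"
      using k(2) that by (auto simp: S_def)
    moreover have "L (\<lambda>x. (k (T u 0 x) - k x)\<^sup>2) =
        L (\<lambda>x. ((k (T u 0 x))\<^sup>2 + (k x)\<^sup>2) - 2 * (k x * k (T u 0 x)))"
      by (intro arg_cong[of _ _ L]) (auto simp: power2_eq_square algebra_simps)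
    then have "L (\<lambda>x. (k (T u 0 x) - k x)\<^sup>2) =
        L (\<lambda>x. (k (T u 0 x))\<^sup>2) + L (\<lambda>x. (k x)\<^sup>2) - 2 * L (\<lambda>x. k x * k (T u 0 x))"
      by (simp add: X.diff X.add X.scale bnd_mult bnd_add bnd_power2)
    ultimately show ?thesis by argo
  qed
  then have "J (\<lambda>_. (L k)\<^sup>2 - e) \<le> J (\<lambda>z. k (snd z) * k (T (fst z) 0 (snd z)))"
    by (intro J_mono_off_0 bnd_const bnd_mult bS k(1)) (simp add: X.const)
  then show "(L h)\<^sup>2 \<le> J (\<lambda>z. h (snd z) * h (T (fst z) 0 (snd z))) + e"
    using right[OF k(1) k(1)] left[OF k(1)] X.midhull_mean[OF inv h k(1)]
    by (simp add: J.const)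
qed

text \<open>The first \<open>f\<close> is exchanged for an almost translation-invariant
  \<open>h\<close> in its hull. For such \<open>h\<close> the translation by \<open>u\<close> hardly
  matters, and the second \<open>f\<close> can then be exchanged for \<open>h\<close> as well,
  leaving a correlation under dilations.\<close>

lemma sum_product_recurrence:
  assumes bound: "\<And>x. \<bar>f x\<bar> \<le> 1"
  shows "(L f)\<^sup>2 \<le> J (\<lambda>p. f (T 1 (fst p) (snd p)) * f (T (fst p) 0 (snd p)))"
proof (rule field_le_epsilon)
  fix e :: real assume e: "0 < e"
  have f: "bnd f" using bound by (rule bndI)
  define S where "S = range (T 1)"
  have inv: "L (\<lambda>x. p (s x)) = L p" if "s \<in> S" "bnd p" for s p
    using that by (auto simp: S_def X.invariant)
  have bS: "bnd (\<lambda>z. p (t z))" if "p \<in> midhull S f" for p and t :: "'y \<Rightarrow> 'x"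
    by (rule bnd_comp) (rule midhull_bnd[OF that f])
  have bf: "bnd (\<lambda>z. f (t z))" for t :: "'y \<Rightarrow> 'x"
    by (rule bnd_comp[OF f])
  obtain h where h: "h \<in> midhull S f" "\<And>s. s \<in> S \<Longrightarrow> L (\<lambda>x. (h (s x) - h x)\<^sup>2) \<le> e\<^sup>2"
    using X.almost_invariant[OF inv f, where e = "e\<^sup>2"] e by auto
  have bh: "bnd (\<lambda>z. h (t z))" for t :: "'y \<Rightarrow> 'x" by (rule bS[OF h(1)])
  \<comment> \<open>One translation changes the average by exactly the quantity that
    \<open>coboundary_average\<close> shows to be zero.\<close>
  have replace: "J (\<lambda>z. p (T 1 (fst z) (snd z)) * f (T (fst z) 0 (snd z))) =
      J (\<lambda>z. f (T 1 (fst z) (snd z)) * f (T (fst z) 0 (snd z)))" if "p \<in> midhull S f" for p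
    using that
  proof induction
    case (shift p s)
    then obtain v where v: "s = T 1 v" by (auto simp: S_def)
    have "bnd p" using shift.hyps(1) f by (rule midhull_bnd)
    from coboundary_average[OF this f, of v] shift.IH show ?case
      by (simp add: v left_diff_distrib J.diff bnd_mult bS[OF shift.hyps(1)] bf)
  next
    case (mid p p')
    then show ?case
      by (simp add: distrib_right add_divide_distrib J.add J.half bnd_mult bnd_half bnd_add
          bS[OF mid.hyps(1)] bS[OF mid.hyps(2)] bf)
  qed simp
  \<comment> \<open>The translation \<open>w\<close> is arbitrary because a shift of
    \<open>p\<close> by \<open>v\<close> is undone by moving \<open>x\<close> by
    \<open>- v / u\<close>, which changes \<open>w\<close>. The case \<open>w = 0\<close>,
    \<open>p = h\<close> is the one wanted.\<close>
  have close: "\<bar>L (\<lambda>x. h (T 1 w x) * p (T u 0 x)) - L (\<lambda>x. h (T 1 u x) * f (T u 0 x))\<bar> \<le> e"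
    if u: "u \<noteq> 0" and "p \<in> midhull S f" for u w p
    using that(2)
  proof (induction arbitrary: w)
    case base
    have "\<bar>L (\<lambda>x. (h (T 1 w x) - h (T 1 u x)) * f (T u 0 x))\<bar> \<le> e"
    proof (rule X.abs_mult_le)
      have "L (\<lambda>x. (h (T 1 w x) - h (T 1 u x))\<^sup>2) =
          L (\<lambda>x. (h (T 1 (w - u) (T 1 u x)) - h (T 1 u x))\<^sup>2)"
        by (simp add: X.T_comp)
      also have "\<dots> = L (\<lambda>x. (h (T 1 (w - u) x) - h x)\<^sup>2)"
        using X.invariant[of 1 "\<lambda>x. (h (T 1 (w - u) x) - h x)\<^sup>2" u]
        by (simp add: bnd_power2 bnd_diff bh)
      also have "\<dots> \<le> e\<^sup>2" by (intro h(2)) (simp add: S_def)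
      finally show "L (\<lambda>x. (h (T 1 w x) - h (T 1 u x))\<^sup>2) \<le> e\<^sup>2" .
    qed (use e bound in \<open>auto intro: bnd_diff bh bf\<close>)
    then show ?case by (simp add: left_diff_distrib X.diff bnd_mult bh bf)
  next
    case (shift p s)
    then obtain v where v: "s = T 1 v" by (auto simp: S_def)
    have "L (\<lambda>x. h (T 1 w x) * p (s (T u 0 x))) =
        L (\<lambda>x. h (T 1 w (T 1 (- v / u) x)) * p (s (T u 0 (T 1 (- v / u) x))))"
      using X.invariant[of 1 "\<lambda>x. h (T 1 w x) * p (s (T u 0 x))" "- v / u"]
      by (simp add: bnd_mult bh bS[OF shift.hyps(1)])
    also have "\<dots> = L (\<lambda>x. h (T 1 (- v / u + w) x) * p (T u 0 x))"
      using u by (simp add: v X.T_comp)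
    finally show ?case using shift.IH by simp
  next
    case (mid p p')
    have "L (\<lambda>x. h (T 1 w x) * ((p (T u 0 x) + p' (T u 0 x)) / 2)) =
        (L (\<lambda>x. h (T 1 w x) * p (T u 0 x)) + L (\<lambda>x. h (T 1 w x) * p' (T u 0 x))) / 2"
      using mid.hyps by (simp add: distrib_left X.add X.half bnd_mult bnd_add bh
          bS[OF mid.hyps(1)] bS[OF mid.hyps(2)])
    then show ?case using mid.IH[of w] by (simp only: abs_le_iff) argo
  qed
  have "J (\<lambda>z. h (snd z) * h (T (fst z) 0 (snd z)) - e)
      \<le> J (\<lambda>z. h (T 1 (fst z) (snd z)) * f (T (fst z) 0 (snd z)))"
  proof (intro J_mono_off_0)
    fix u :: 'a assume u: "u \<noteq> 0"
    show "L (\<lambda>x. h (snd (u, x)) * h (T (fst (u, x)) 0 (snd (u, x))) - e) \<le>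
        L (\<lambda>x. h (T 1 (fst (u, x)) (snd (u, x))) * f (T (fst (u, x)) 0 (snd (u, x))))"
      using close[OF u h(1), of 0]
      by (simp add: X.T_id X.diff X.const bnd_mult bh abs_le_iff)
  qed (intro bnd_diff bnd_mult bnd_const bh bf)+
  moreover have "J (\<lambda>z. h (snd z) * h (T (fst z) 0 (snd z)) - e) =
      J (\<lambda>z. h (snd z) * h (T (fst z) 0 (snd z))) - e"
    by (simp add: J.diff J.const bnd_mult bh)
  moreover have "L h = L f" by (rule X.midhull_mean[OF inv f h(1)])
  moreover have "(L h)\<^sup>2 \<le> J (\<lambda>z. h (snd z) * h (T (fst z) 0 (snd z)))"
    by (rule dilation_recurrence) (rule midhull_bnd[OF h(1) f])
  ultimately show "(L f)\<^sup>2 \<le> J (\<lambda>z. f (T 1 (fst z) (snd z)) * f (T (fst z) 0 (snd z))) + e"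
    using replace[OF h(1)] by simp
qed

end

section \<open>Finite powers of a mean, and all colours at once\<close>

text \<open>Lists give all powers a common type; only the values of \<open>f\<close> on lists of
  length \<open>n\<close> enter.\<close>

primrec mean_power :: "(('a \<Rightarrow> real) \<Rightarrow> real) \<Rightarrow> nat \<Rightarrow> ('a list \<Rightarrow> real) \<Rightarrow> real" where
  "mean_power m 0 f = f []"
| "mean_power m (Suc n) f = m (\<lambda>x. mean_power m n (\<lambda>xs. f (x # xs)))"

abbreviation list_action :: "'a::field \<Rightarrow> 'a \<Rightarrow> 'a list \<Rightarrow> 'a list" where
  "list_action a b \<equiv> map (line_action a b)"

lemma mean_mean_power:
  assumes "mean m"
  shows "mean (mean_power m n)"
proof (induction n)
  case 0
  then show ?case by standard (auto simp: fun_eq_iff)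
next
  case (Suc n)
  have "mean (\<lambda>f. m (\<lambda>x. mean_power m n (\<lambda>xs. f (fst (x, xs) # snd (x, xs)))))"
    by (rule mean_push[OF mean_prod[OF assms Suc.IH], of "\<lambda>p. fst p # snd p"])
  also have "(\<lambda>f. m (\<lambda>x. mean_power m n (\<lambda>xs. f (fst (x, xs) # snd (x, xs))))) = mean_power m (Suc n)"
    by (rule ext) simp
  finally show ?case .
qed

text \<open>The same affine map acts on every coordinate, so the coordinates can be treated one at a
  time.\<close>

lemma mean_power_invariant:
  fixes m :: "('a::field \<Rightarrow> real) \<Rightarrow> real"
  assumes "affine_mean m line_action" and "a \<noteq> 0" and "bnd f"
  shows "mean_power m n (\<lambda>xs. f (list_action a b xs)) = mean_power m n f"
  using assms(3)
proof (induction n arbitrary: f)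
  case 0
  then show ?case by simp
next
  case (Suc n)
  interpret affine_mean m line_action by fact
  interpret P: mean "mean_power m n" by (rule mean_mean_power) (rule mean_axioms)
  have "mean_power m n (\<lambda>xs. f ((a * x + b) # list_action a b xs)) = mean_power m n (\<lambda>xs. f ((a * x + b) # xs))" for x
    by (rule Suc.IH) (rule bnd_comp[OF Suc.prems])
  moreover have "bnd (\<lambda>x. mean_power m n (\<lambda>xs. f (x # xs)))"
    using P.bnd_fibre_mean[OF bnd_comp[OF Suc.prems, of "\<lambda>p. fst p # snd p"]] by simp
  ultimately show ?case
    using invariant[OF assms(2), of "\<lambda>x. mean_power m n (\<lambda>xs. f (x # xs))" b] by simp
qed

lemma affine_mean_power:
  fixes m :: "('a::field \<Rightarrow> real) \<Rightarrow> real"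
  assumes "affine_mean m line_action"
  shows "affine_mean (mean_power m n) list_action"
proof -
  interpret affine_mean m line_action by fact
  interpret P: mean "mean_power m n" by (rule mean_mean_power) (rule mean_axioms)
  show ?thesis
    by standard (simp_all add: mean_power_invariant[OF assms] ring_distribs mult.assoc add.assoc)
qed

text \<open>Surplus entries of either list are ignored; \<open>mean_power\<close> is only applied
  with matching lengths.\<close>

fun box_indicator :: "'a set list \<Rightarrow> 'a list \<Rightarrow> real" where
  "box_indicator [] xs = 1"
| "box_indicator (A # As) [] = 1"
| "box_indicator (A # As) (x # xs) = indicator A x * box_indicator As xs"

lemma box_range: "0 \<le> box_indicator As xs \<and> box_indicator As xs \<le> 1"
  by (induction As xs rule: box_indicator.induct) (auto simp: indicator_def)

lemma abs_box_le: "\<bar>box_indicator As xs\<bar> \<le> 1"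
  using box_range[of As xs] by simp

lemma bnd_box: "bnd (\<lambda>x. box_indicator As (t x))"
  by (rule bndI[OF abs_box_le])

text \<open>The coordinates are independent: for a fixed head, its indicator is a constant factor of
  the remaining mean.\<close>

lemma mean_power_box:
  assumes "mean m"
  shows "mean_power m (length As) (\<lambda>xs. box_indicator As (map g xs) * box_indicator As (map h xs)) =
    (\<Prod>A\<leftarrow>As. m (indicator {x. g x \<in> A \<and> h x \<in> A}))"
proof (induction As)
  case Nil
  then show ?case by simp
next
  case (Cons A As)
  interpret m: mean m by fact
  interpret P: mean "mean_power m (length As)" by (rule mean_mean_power) fact
  let ?P = "\<Prod>A\<leftarrow>As. m (indicator {x. g x \<in> A \<and> h x \<in> A})"
  have "mean_power m (length As) (\<lambda>xs. box_indicator (A # As) (map g (x # xs)) * box_indicator (A # As) (map h (x # xs))) =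
      ?P * indicator {x. g x \<in> A \<and> h x \<in> A} x" for x
  proof -
    have "box_indicator (A # As) (map g (x # xs)) * box_indicator (A # As) (map h (x # xs)) =
        indicator {x. g x \<in> A \<and> h x \<in> A} x * (box_indicator As (map g xs) * box_indicator As (map h xs))" for xs
      by (simp add: indicator_def)
    then have "mean_power m (length As) (\<lambda>xs. box_indicator (A # As) (map g (x # xs)) *
          box_indicator (A # As) (map h (x # xs))) =
        mean_power m (length As) (\<lambda>xs. indicator {x. g x \<in> A \<and> h x \<in> A} x *
          (box_indicator As (map g xs) * box_indicator As (map h xs)))"
      by presburger
    also have "\<dots> = indicator {x. g x \<in> A \<and> h x \<in> A} x * ?P"
      unfolding Cons.IH[symmetric] by (intro P.scale bnd_mult bnd_box)
    finally show ?thesis by (simp only: mult.commute)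
  qed
  then show ?case
    using m.scale[of "indicator {x. g x \<in> A \<and> h x \<in> A}" ?P] by (simp add: mult.commute)
qed

text \<open>On the power system the averaged correlation of the box is an average over
  \<open>u\<close> of a product with one factor per set. It is positive, while the product vanishes
  as soon as one factor does, that is, for \<open>u\<close> outside \<open>?R\<close>.\<close>

lemma simultaneous_recurrence:
  fixes m :: "('a::field \<Rightarrow> real) \<Rightarrow> real"
  assumes m: "affine_mean m line_action" and inf: "infinite (UNIV :: 'a set)"
    and pos: "\<And>A. A \<in> set As \<Longrightarrow> 0 < m (indicator A)"
  shows "0 < m (indicator {u. \<forall>A\<in>set As. 0 < m (indicator {y. y + u \<in> A \<and> y * u \<in> A})})"
proof -
  let ?n = "length As" and ?R = "{u. \<forall>A\<in>set As. 0 < m (indicator {y. y + u \<in> A \<and> y * u \<in> A})}"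
  interpret m: affine_mean m line_action by fact
  interpret affine_pair m "mean_power m ?n" list_action
    unfolding affine_pair_def affine_pair_axioms_def using affine_mean_power[OF m] m inf by blast
  have prod: "mean_power m ?n (\<lambda>xs. box_indicator As (map g xs) * box_indicator As (map h xs)) =
    (\<Prod>A\<leftarrow>As. m (indicator {x. g x \<in> A \<and> h x \<in> A}))" for g h
    by (rule mean_power_box) (rule m.mean_axioms)
  have prod_pos: "0 < (\<Prod>A\<leftarrow>Bs. c A)" if "\<And>A. A \<in> set Bs \<Longrightarrow> 0 < c A" for c :: "'a set \<Rightarrow> real" and Bs
    using that by (induction Bs) auto
  \<comment> \<open>\<open>mean_power_box\<close> treats products of two boxes, so the mean of the
    box is bounded below through its square.\<close>
  have "0 < mean_power m ?n (\<lambda>xs. box_indicator As xs * box_indicator As xs)"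
    using prod[of "\<lambda>x. x" "\<lambda>x. x"] prod_pos[of As "\<lambda>A. m (indicator A)"] pos by simp
  also have "\<dots> \<le> mean_power m ?n (box_indicator As)"
    using box_range[of As] by (intro X.mono bnd_mult bnd_box bnd_box[of _ "\<lambda>x. x"]) (simp add: mult_left_le)
  finally have "0 < (mean_power m ?n (box_indicator As))\<^sup>2" by simp
  also have "\<dots> \<le> J (\<lambda>p. box_indicator As (list_action 1 (fst p) (snd p)) * box_indicator As (list_action (fst p) 0 (snd p)))"
    by (rule sum_product_recurrence) (rule abs_box_le)
  also have "\<dots> \<le> m (indicator ?R)"
    unfolding J_def
  proof (intro mono_off_0 bnd_indicator X.bnd_fibre_mean bnd_mult bnd_box)
    fix u
    let ?q = "\<lambda>A. m (indicator {y. y + u \<in> A \<and> y * u \<in> A})"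
    have q: "0 \<le> ?q A \<and> ?q A \<le> 1" for A
      using m.nonneg[of "indicator {y. y + u \<in> A \<and> y * u \<in> A}"]
        m.mono[of "indicator {y. y + u \<in> A \<and> y * u \<in> A}" "\<lambda>_. 1"]
      by (simp add: m.one indicator_def)
    have le: "(\<Prod>A\<leftarrow>Bs. ?q A) \<le> 1 \<and> 0 \<le> (\<Prod>A\<leftarrow>Bs. ?q A)" for Bs
      using q by (induction Bs) (auto intro: mult_le_one)
    have "(\<Prod>A\<leftarrow>As. ?q A) \<le> indicator ?R u"
    proof (cases "u \<in> ?R")
      case False
      then obtain A where "A \<in> set As" "?q A = 0" using q by (auto simp: not_less intro: antisym)
      then have "(\<Prod>A\<leftarrow>As. ?q A) = 0" by (auto simp: prod_list_zero_iff)
      then show ?thesis using False by simp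
    qed (use le in simp)
    then show "mean_power m ?n (\<lambda>x. box_indicator As (list_action 1 (fst (u, x)) (snd (u, x))) *
        box_indicator As (list_action (fst (u, x)) 0 (snd (u, x)))) \<le> indicator ?R u"
      by (simp add: prod mult.commute)
  qed
  finally show ?thesis .
qed

section \<open>An affinely invariant mean from the Folner averages\<close>

text \<open>By Tychonoff the functionals lie in a compact product of intervals and have a cluster
  point there, which inherits every closed condition that eventually holds.\<close>

lemma ex_cluster_functional:
  fixes E :: "nat \<Rightarrow> 'b \<Rightarrow> real"
  assumes "\<And>N f. \<bar>E N f\<bar> \<le> c f"
  obtains m where "\<And>S. closed S \<Longrightarrow> eventually (\<lambda>N. E N \<in> S) sequentially \<Longrightarrow> m \<in> S"
proof -
  let ?K = "PiE UNIV (\<lambda>f. {- c f..c f})"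
  have "compactin (product_topology (\<lambda>_. euclidean) UNIV) ?K"
    by (subst compactin_PiE) simp
  then have "compact ?K"
    by (simp add: euclidean_product_topology)
  moreover have "filtermap E sequentially \<noteq> bot" by (simp add: filtermap_bot_iff)
  moreover have "eventually (\<lambda>g. g \<in> ?K) (filtermap E sequentially)"
    using assms by (simp add: eventually_filtermap PiE_iff abs_le_iff minus_le_iff)
  ultimately obtain m where m: "inf (nhds m) (filtermap E sequentially) \<noteq> bot"
    unfolding compact_filter by blast
  have "m \<in> S" if "closed S" "eventually (\<lambda>N. E N \<in> S) sequentially" for S
  proof (rule ccontr)
    assume "m \<notin> S"
    then have "eventually (\<lambda>g. g \<in> - S) (nhds m)"
      using that(1) by (intro eventually_nhds_in_open) auto
    moreover have "eventually (\<lambda>g. g \<in> S) (filtermap E sequentially)"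
      using that(2) by (simp add: eventually_filtermap)
    ultimately have "eventually (\<lambda>_. False) (inf (nhds m) (filtermap E sequentially))"
      unfolding eventually_inf by (metis ComplD)
    then show False using m by (simp add: trivial_limit_def)
  qed
  then show ?thesis by (rule that)
qed

lemma abs_sum_shift_le:
  fixes f :: "'a \<Rightarrow> real"
  assumes fin: "finite A" and t: "inj t" and c: "\<And>x. \<bar>f x\<bar> \<le> c"
  shows "\<bar>(\<Sum>x\<in>A. f (t x)) - (\<Sum>x\<in>A. f x)\<bar> \<le> 2 * c * (real (card A) - real (card (A \<inter> t ` A)))"
proof -
  have card: "card (t ` A) = card A"
    using t by (metis card_image inj_on_subset subset_UNIV)
  have le: "\<bar>sum f B\<bar> \<le> real (card B) * c" for B
    using sum_norm_bound[of B f c] c by simp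
  have "(\<Sum>x\<in>A. f (t x)) = sum f (t ` A)"
    using t by (simp add: sum.reindex inj_on_subset)
  also have "\<dots> = sum f (t ` A \<inter> A) + sum f (t ` A - A)"
    using fin by (simp add: sum.Int_Diff)
  finally have "(\<Sum>x\<in>A. f (t x)) - (\<Sum>x\<in>A. f x) = sum f (t ` A - A) - sum f (A - t ` A)"
    using sum.Int_Diff[OF fin, of f "t ` A"] by (simp add: Int_commute)
  also have "\<bar>\<dots>\<bar> \<le> (real (card (t ` A - A)) + real (card (A - t ` A))) * c"
    using le[of "t ` A - A"] le[of "A - t ` A"] by (simp add: distrib_right)
  also have "real (card (t ` A - A)) = real (card A) - real (card (A \<inter> t ` A))"
    using fin card card_Int_Diff[of "t ` A" A] by (simp add: Int_commute)
  also have "real (card (A - t ` A)) = real (card A) - real (card (A \<inter> t ` A))"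
    using card_Int_Diff[OF fin, of "t ` A"] by simp
  finally show ?thesis by (simp add: mult_ac)
qed

text \<open>Linearity and positivity are closed conditions met by every average; invariance holds in
  the limit by the Folner property.\<close>

lemma ex_folner_mean:
  fixes F :: "nat \<Rightarrow> 'a::field set"
  assumes F: "double_folner F"
  obtains m where "affine_mean m line_action"
    and "\<And>E. 0 < m (indicator E) \<Longrightarrow> 0 < upper_density F E"
proof -
  have fin: "finite (F N)" and card_pos: "0 < card (F N)" for N
    using F by (auto simp: double_folner_def card_gt_0_iff)
  \<comment> \<open>The value 0 on unbounded functions keeps every coordinate bounded in
    \<open>N\<close>, as compactness demands.\<close>
  define avg where "avg N f = (if bnd f then (\<Sum>x\<in>F N. f x) / real (card (F N)) else 0)" for N f
  have "\<exists>c. \<forall>N. \<bar>avg N f\<bar> \<le> c" for f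
  proof (cases "bnd f")
    case True
    then obtain c where c: "\<And>x. \<bar>f x\<bar> \<le> c" by (auto simp: bnd_def)
    have "\<bar>avg N f\<bar> \<le> c" for N
      using sum_norm_bound[of "F N" f c] c card_pos[of N] True
      by (simp add: avg_def field_simps)
    then show ?thesis by blast
  qed (auto simp: avg_def)
  then obtain c where "\<And>N f. \<bar>avg N f\<bar> \<le> c f" by metis
  then obtain m where m: "\<And>S. closed S \<Longrightarrow> eventually (\<lambda>N. avg N \<in> S) sequentially \<Longrightarrow> m \<in> S"
    using ex_cluster_functional[of avg c] by blast
  have transfer: "P m" if "closed {m. P m}" "\<And>N. P (avg N)" for P
    using m[OF that(1)] that(2) by simp
  have limit: "\<bar>m f - m g\<bar> = 0" if "(\<lambda>N. avg N f - avg N g) \<longlonglongrightarrow> 0" for f g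
  proof -
    have "\<bar>m f - m g\<bar> \<le> e" if e: "0 < e" for e
    proof -
      have "eventually (\<lambda>N. \<bar>avg N f - avg N g\<bar> \<le> e) sequentially"
        using tendstoD[OF \<open>(\<lambda>N. avg N f - avg N g) \<longlonglongrightarrow> 0\<close> e] by eventually_elim simp
      then show ?thesis
        using m[of "{m. \<bar>m f - m g\<bar> \<le> e}"]
        by (simp add: closed_Collect_le continuous_intros)
    qed
    then show ?thesis by (metis abs_ge_zero dense_ge order_antisym)
  qed
  have inv: "m (\<lambda>x. f (t x)) = m f"
    if t: "inj t" and lim: "(\<lambda>N. real (card (F N \<inter> t ` F N)) / real (card (F N))) \<longlonglongrightarrow> 1"
      and f: "bnd f" for t :: "'a \<Rightarrow> 'a" and f
  proof -
    obtain c where c: "\<And>x. \<bar>f x\<bar> \<le> c" using f by (auto simp: bnd_def)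
    have "(\<lambda>N. avg N (\<lambda>x. f (t x)) - avg N f) \<longlonglongrightarrow> 0"
    proof (rule Lim_null_comparison)
      show "\<forall>\<^sub>F N in sequentially. norm (avg N (\<lambda>x. f (t x)) - avg N f) \<le>
          2 * c * (1 - real (card (F N \<inter> t ` F N)) / real (card (F N)))"
        using abs_sum_shift_le[OF fin t, of f c, OF c] card_pos f bnd_comp[OF f, of t]
        by (intro always_eventually allI) (simp add: avg_def field_simps flip: diff_divide_distrib)
      show "(\<lambda>N. 2 * c * (1 - real (card (F N \<inter> t ` F N)) / real (card (F N)))) \<longlonglongrightarrow> 0"
        using tendsto_mult[OF tendsto_const tendsto_diff[OF tendsto_const lim], of "2 * c" 1] by simp
    qed
    then show ?thesis using limit by simp
  qed
  have "affine_mean m line_action"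
  proof
    show "m (\<lambda>x. f x + g x) = m f + m g" if "bnd f" "bnd g" for f g
      using that
      by (intro transfer[where P = "\<lambda>m. m (\<lambda>x. f x + g x) = m f + m g"] closed_Collect_eq continuous_intros)
        (auto simp: avg_def bnd_add sum.distrib add_divide_distrib)
    show "m (\<lambda>x. c * f x) = c * m f" if "bnd f" for f c
      using that
      by (intro transfer[where P = "\<lambda>m. m (\<lambda>x. c * f x) = c * m f"] closed_Collect_eq continuous_intros)
        (auto simp: avg_def bnd_mult sum_distrib_left)
    show "0 \<le> m f" if "bnd f" "\<And>x. 0 \<le> f x" for f
      using that
      by (intro transfer[where P = "\<lambda>m. 0 \<le> m f"] closed_Collect_le continuous_intros)
        (auto simp: avg_def sum_nonneg)
    show "m (\<lambda>_. 1) = 1"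
      using card_pos
      by (intro transfer[where P = "\<lambda>m. m (\<lambda>_. 1) = 1"] closed_Collect_eq continuous_intros)
        (auto simp: avg_def)
    show "m (\<lambda>x. f (a * x + b)) = m f" if a: "a \<noteq> 0" and f: "bnd f" for a b f
    proof -
      have "m (\<lambda>x. f (a * x + b)) = m (\<lambda>x. f (x + b))"
        using F a by (intro inv[of "\<lambda>x. a * x" "\<lambda>x. f (x + b)"] bnd_comp[OF f])
          (auto simp: double_folner_def inj_def)
      \<comment> \<open>The Folner property speaks of nonzero translations only, hence the separate
        case \<open>b = 0\<close>.\<close>
      also have "\<dots> = m f"
        using F f inv[of "\<lambda>x. x + b"] by (cases "b = 0") (auto simp: double_folner_def inj_def)
      finally show ?thesis .
    qed
  qed (simp_all add: algebra_simps)
  moreover have "0 < upper_density F E" if pos: "0 < m (indicator E)" for E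
  proof (rule ccontr)
    assume "\<not> 0 < upper_density F E"
    \<comment> \<open>Any bound strictly between 0 and the mean would do: the averages eventually
      fall below it, and so would \<open>m\<close>.\<close>
    then have "upper_density F E < ereal (m (indicator E) / 2)"
      using pos by (auto simp: not_less intro: le_less_trans)
    then have "eventually (\<lambda>N. real (card (E \<inter> F N)) / real (card (F N)) < m (indicator E) / 2) sequentially"
      unfolding upper_density_def by (drule_tac Limsup_lessD) simp
    then have "eventually (\<lambda>N. avg N (indicator E) \<le> m (indicator E) / 2) sequentially"
    proof eventually_elim
      case (elim N)
      have "(\<Sum>x\<in>F N. indicator E x) = real (card (E \<inter> F N))"
        using fin by (simp add: indicator_def Int_commute sum.If_cases flip: Int_def)
      then show ?case using elim by (simp add: avg_def)
    qed
    then have "m (indicator E) \<le> m (indicator E) / 2"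
      using m[of "{g. g (indicator E) \<le> m (indicator E) / 2}"]
      by (simp add: closed_Collect_le continuous_intros)
    then show False using pos by simp
  qed
  ultimately show ?thesis by (rule that)
qed

section \<open>Selecting a colour that meets the common return set\<close>

theorem theorem4p1:
  fixes F :: "nat \<Rightarrow> 'a::field set" and C :: "nat \<Rightarrow> 'a set" and r :: nat
  assumes "countable (UNIV :: 'a set)" and "infinite (UNIV :: 'a set)"
    and "double_folner F"
    and "(\<Union>i\<in>{1..r}. C i) = UNIV"
  shows "\<exists>i\<in>{1..r}. \<exists>D. upper_density F D > 0 \<and>
           (\<exists>D'. \<forall>u\<in>D. upper_density F (D' u) > 0 \<and>
              (\<forall>y\<in>D' u. {u, y + u, y * u} \<subseteq> C i))"
proof -
  obtain m where m: "affine_mean m line_action"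
    and dens: "\<And>E. 0 < m (indicator E) \<Longrightarrow> 0 < upper_density F E"
    using ex_folner_mean[OF assms(3)] by blast
  interpret affine_mean m line_action by fact
  \<comment> \<open>Colours of zero mean are left out because \<open>simultaneous_recurrence\<close>
    needs positive means.\<close>
  obtain As where As: "set As = {A \<in> C ` {1..r}. 0 < m (indicator A)}"
    using finite_list[of "{A \<in> C ` {1..r}. 0 < m (indicator A)}"] by auto
  define R where "R = {u. \<forall>A\<in>set As. 0 < m (indicator {y. y + u \<in> A \<and> y * u \<in> A})}"
  have "0 < m (indicator R)"
    unfolding R_def using m assms(2) by (rule simultaneous_recurrence) (simp add: As)
  also have "\<dots> \<le> m (\<lambda>x. \<Sum>i\<in>{1..r}. indicator (C i \<inter> R) x)"
  proof (intro mono bnd_sum bnd_indicator)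
    fix x
    obtain i where i: "i \<in> {1..r}" "x \<in> C i" using assms(4) by blast
    have "indicator R x = (indicator (C i \<inter> R) x :: real)" using i by (simp add: indicator_def)
    also have "\<dots> \<le> (\<Sum>i\<in>{1..r}. indicator (C i \<inter> R) x)"
      using i by (intro member_le_sum) auto
    finally show "indicator R x \<le> (\<Sum>i\<in>{1..r}. indicator (C i \<inter> R) x :: real)" .
  qed
  also have "\<dots> = (\<Sum>i\<in>{1..r}. m (indicator (C i \<inter> R)))"
    using sum[of "{1..r}" "\<lambda>i. indicator (C i \<inter> R)"] by simp
  finally obtain i where i: "i \<in> {1..r}" "0 < m (indicator (C i \<inter> R))"
    by (metis not_less sum_nonpos)
  \<comment> \<open>The chosen colour has positive mean itself, so it is among \<open>As\<close> and
    the definition of \<open>R\<close> applies to it.\<close>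
  have "m (indicator (C i \<inter> R)) \<le> m (indicator (C i))"
    by (intro mono) (auto simp: indicator_def)
  then have "C i \<in> set As" using i by (auto simp: As)
  then have "0 < upper_density F {y. y + u \<in> C i \<and> y * u \<in> C i}" if "u \<in> C i \<inter> R" for u
    using that by (intro dens) (simp add: R_def)
  with i show ?thesis
    by (intro bexI[of _ i] exI[of _ "C i \<inter> R"] conjI dens
        exI[of _ "\<lambda>u. {y. y + u \<in> C i \<and> y * u \<in> C i}"]) auto
qed

end
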